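(* The only degree definable in $(\mathbf{Peq},\leq)$ is the greatest degree, $\deg(\mathrm{Id})$. Moreover, no nonempty finite set of degrees is definable in $(\mathbf{Peq},\leq)$ except for $\{\deg(\mathrm{Id})\}$.
   Context: A punctual equivalence relation is a primitive recursive equivalence relation with domain $\omega$ having infinitely many equivalence classes. $\mathrm{Id}$ is equality on $\omega$. For equivalence relations $R,S$ on $\omega$, $R\leq_{pr} S$ means that there is a primitive recursive function $f:\omega\to\omega$ such that for all $x,y\in\omega$, $x\mathrel{R}y \Leftrightarrow f(x)\mathrel{S}f(y)$. Write $R\equiv_{pr}S$ if $R\leq_{pr}S$ and $S\leq_{pr}R$. $(\mathbf{Peq},\leq)$ is the partial order of $\equiv_{pr}$-classes $\deg(R)$ of punctual equivalence relations $R$, ordered by the order induced by $\leq_{pr}$. Definable means first-order definable without parameters in the language of partial orders. *)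

theory Defs
  imports Main
begin

(* primrec_fun n f: f agrees with an n-ary primitive recursive function on lists of length n;
   the values of f on lists of any other length carry no meaning. *)
inductive primrec_fun :: "nat \<Rightarrow> (nat list \<Rightarrow> nat) \<Rightarrow> bool" where
  zero: "primrec_fun n (\<lambda>_. 0)"
| succ: "primrec_fun 1 (\<lambda>xs. Suc (xs ! 0))"
| proj: "i < n \<Longrightarrow> primrec_fun n (\<lambda>xs. xs ! i)"
| comp: "primrec_fun (length gs) f \<Longrightarrow> (\<forall>g\<in>set gs. primrec_fun n g) \<Longrightarrow>
    primrec_fun n (\<lambda>xs. f (map (\<lambda>g. g xs) gs))"
| prec: "primrec_fun n f \<Longrightarrow> primrec_fun (n + 2) g \<Longrightarrow>
    primrec_fun (n + 1) (\<lambda>xs. rec_nat (f (tl xs)) (\<lambda>y r. g (y # r # tl xs)) (hd xs))"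

definition primrec1 :: "(nat \<Rightarrow> nat) \<Rightarrow> bool" where
  "primrec1 f \<longleftrightarrow> (\<exists>g. primrec_fun 1 g \<and> (\<forall>x. f x = g [x]))"

definition primrec_rel :: "(nat \<times> nat) set \<Rightarrow> bool" where
  "primrec_rel R \<longleftrightarrow>
    (\<exists>g. primrec_fun 2 g \<and> (\<forall>x y. g [x, y] = (if (x, y) \<in> R then 1 else 0)))"

definition punctual :: "(nat \<times> nat) set \<Rightarrow> bool" where
  "punctual R \<longleftrightarrow> equiv UNIV R \<and> primrec_rel R \<and> infinite (UNIV // R)"

definition pr_le :: "(nat \<times> nat) set \<Rightarrow> (nat \<times> nat) set \<Rightarrow> bool"  (infix "\<le>\<^sub>p" 50) where
  "R \<le>\<^sub>p S \<longleftrightarrow> (\<exists>f. primrec1 f \<and> (\<forall>x y. (x, y) \<in> R \<longleftrightarrow> (f x, f y) \<in> S))"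

definition pr_equiv :: "((nat \<times> nat) set \<times> (nat \<times> nat) set) set" where
  "pr_equiv = {(R, S). punctual R \<and> punctual S \<and> R \<le>\<^sub>p S \<and> S \<le>\<^sub>p R}"

definition deg :: "(nat \<times> nat) set \<Rightarrow> (nat \<times> nat) set set" where
  "deg R = pr_equiv `` {R}"

definition Peq :: "(nat \<times> nat) set set set" where
  "Peq = {R. punctual R} // pr_equiv"

definition Peq_le :: "(nat \<times> nat) set set \<Rightarrow> (nat \<times> nat) set set \<Rightarrow> bool" where
  "Peq_le a b \<longleftrightarrow> (\<exists>R\<in>a. \<exists>S\<in>b. R \<le>\<^sub>p S)"

lemma pr_le_refl: "R \<le>\<^sub>p R"
  unfolding pr_le_def primrec1_def
  by (rule exI[of _ "\<lambda>x. x"]) (auto intro!: exI[of _ "\<lambda>xs. xs ! 0"] primrec_fun.proj)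

lemma pr_le_trans:
  assumes "R \<le>\<^sub>p S" "S \<le>\<^sub>p T"
  shows "R \<le>\<^sub>p T"
proof -
  obtain f f' where f: "primrec_fun 1 f'" "\<And>x. f x = f' [x]"
      "\<And>x y. (x, y) \<in> R \<longleftrightarrow> (f x, f y) \<in> S"
    using assms(1) unfolding pr_le_def primrec1_def by blast
  obtain h h' where h: "primrec_fun 1 h'" "\<And>x. h x = h' [x]"
      "\<And>x y. (x, y) \<in> S \<longleftrightarrow> (h x, h y) \<in> T"
    using assms(2) unfolding pr_le_def primrec1_def by blast
  have "primrec_fun 1 (\<lambda>xs. h' (map (\<lambda>g. g xs) [f']))"
    by (rule primrec_fun.comp) (use f h in auto)
  then have "primrec1 (h \<circ> f)"
    unfolding primrec1_def using f(2) h(2) by auto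
  then show ?thesis
    unfolding pr_le_def using f(3) h(3) by (metis comp_apply)
qed

lemma equiv_pr_equiv: "equiv {R. punctual R} pr_equiv"
  by (rule equivI)
    (auto simp: pr_equiv_def refl_on_def sym_def trans_def intro: pr_le_refl pr_le_trans)

lemma Peq_le_deg:
  assumes "punctual R" "punctual S"
  shows "Peq_le (deg R) (deg S) \<longleftrightarrow> R \<le>\<^sub>p S"
  using assms unfolding Peq_le_def deg_def pr_equiv_def
  by (auto intro: pr_le_refl pr_le_trans)

datatype po_formula =
    Eq nat nat
  | Leq nat nat
  | Neg po_formula
  | Conj po_formula po_formula
  | Exi nat po_formula

primrec free_vars :: "po_formula \<Rightarrow> nat set" where
  "free_vars (Eq x y) = {x, y}"
| "free_vars (Leq x y) = {x, y}"
| "free_vars (Neg p) = free_vars p"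
| "free_vars (Conj p q) = free_vars p \<union> free_vars q"
| "free_vars (Exi x p) = free_vars p - {x}"

primrec sat :: "'a set \<Rightarrow> ('a \<Rightarrow> 'a \<Rightarrow> bool) \<Rightarrow> (nat \<Rightarrow> 'a) \<Rightarrow> po_formula \<Rightarrow> bool" where
  "sat M le e (Eq x y) \<longleftrightarrow> e x = e y"
| "sat M le e (Leq x y) \<longleftrightarrow> le (e x) (e y)"
| "sat M le e (Neg p) \<longleftrightarrow> \<not> sat M le e p"
| "sat M le e (Conj p q) \<longleftrightarrow> sat M le e p \<and> sat M le e q"
| "sat M le e (Exi x p) \<longleftrightarrow> (\<exists>a\<in>M. sat M le (e(x := a)) p)"

(* Only the value of the assignment at the single free variable x matters,
   so the constant assignment interprets x as a. *)
definition definable_set :: "'a set \<Rightarrow> ('a \<Rightarrow> 'a \<Rightarrow> bool) \<Rightarrow> 'a set \<Rightarrow> bool" where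
  "definable_set M le A \<longleftrightarrow>
    (\<exists>p x. free_vars p \<subseteq> {x} \<and> A = {a \<in> M. sat M le (\<lambda>_. a) p})"

definition definable_elem :: "'a set \<Rightarrow> ('a \<Rightarrow> 'a \<Rightarrow> bool) \<Rightarrow> 'a \<Rightarrow> bool" where
  "definable_elem M le a \<longleftrightarrow> definable_set M le {a}"

end

theory Submission
  imports Defs
begin

text \<open>
  Adding one new equivalence class to a relation \<open>R\<close> induces an automorphism \<open>\<sigma>\<close> of the degree
  structure. It reflects the order because a reduction between two enlarged relations can be
  rerouted around the new classes, and it is onto because merging two classes of \<open>R\<close> undoes it up
  to equivalence.

  The automorphism moves every degree but the greatest one, and it moves it strictly upwards.
  Indeed, suppose that \<open>f\<close> reduces \<open>R\<close> plus a new class to \<open>R\<close>. Then \<open>f\<close> provides an \<open>R\<close>-class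
  outside the range of a self-reduction of \<open>R\<close>, and iterating the self-reduction from there yields
  pairwise inequivalent elements, primitive recursively; so equality reduces to \<open>R\<close>. Hence the
  orbit of every degree other than \<open>deg Id\<close> under \<open>\<sigma>\<close> is infinite.

  A definable set is closed under automorphisms, so a finite one contains no degree other than
  \<open>deg Id\<close>. Conversely, the greatest element of a partial order is definable in it.
\<close>

section \<open>Closure properties of primitive recursive functions\<close>

text \<open>Only the values on lists of length \<open>n\<close> matter, so that closure properties can be stated for
  the functions that actually occur, not just for the canonical representatives built by
  \<^const>\<open>primrec_fun\<close>.\<close>

definition primrec_on :: "nat \<Rightarrow> (nat list \<Rightarrow> nat) \<Rightarrow> bool" where
  "primrec_on n f \<longleftrightarrow> (\<exists>g. primrec_fun n g \<and> (\<forall>xs. length xs = n \<longrightarrow> f xs = g xs))"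

lemma primrec_on_cong:
  assumes "\<And>xs. length xs = n \<Longrightarrow> f xs = g xs"
  shows "primrec_on n f \<longleftrightarrow> primrec_on n g"
  using assms unfolding primrec_on_def by auto

lemma primrec1_iff: "primrec1 f \<longleftrightarrow> primrec_on 1 (\<lambda>xs. f (xs ! 0))"
proof -
  have "(\<forall>x. f x = g [x]) \<longleftrightarrow> (\<forall>xs. length xs = 1 \<longrightarrow> f (xs ! 0) = g xs)"
    for g :: "nat list \<Rightarrow> nat"
    by (auto simp: length_Suc_conv)
  then show ?thesis
    unfolding primrec1_def primrec_on_def by simp
qed

lemma primrec_rel_iff:
  "primrec_rel R \<longleftrightarrow> primrec_on 2 (\<lambda>xs. if (xs ! 0, xs ! 1) \<in> R then 1 else 0)"
proof -
  have "(\<forall>x y. g [x, y] = (if (x, y) \<in> R then 1 else 0)) \<longleftrightarrow>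
      (\<forall>xs. length xs = 2 \<longrightarrow> (if (xs ! 0, xs ! 1) \<in> R then 1 else 0) = g xs)"
    for g :: "nat list \<Rightarrow> nat"
    by (auto simp: numeral_2_eq_2 length_Suc_conv)
  then show ?thesis
    unfolding primrec_rel_def primrec_on_def by simp
qed

lemma primrec_on_proj: "i < n \<Longrightarrow> primrec_on n (\<lambda>xs. xs ! i)"
  unfolding primrec_on_def using primrec_fun.proj by blast

lemma primrec_on_compose:
  assumes "primrec_on (length gs) f" and "\<forall>g\<in>set gs. primrec_on n g"
  shows "primrec_on n (\<lambda>xs. f (map (\<lambda>g. g xs) gs))"
proof -
  obtain f' where f': "primrec_fun (length gs) f'" "\<And>ys. length ys = length gs \<Longrightarrow> f ys = f' ys"
    using assms(1) unfolding primrec_on_def by blast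
  obtain c where c: "\<And>g. g \<in> set gs \<Longrightarrow> primrec_fun n (c g)"
      "\<And>g xs. g \<in> set gs \<Longrightarrow> length xs = n \<Longrightarrow> g xs = c g xs"
    using assms(2) unfolding primrec_on_def by metis
  have "primrec_fun n (\<lambda>xs. f' (map (\<lambda>g. g xs) (map c gs)))"
    by (rule primrec_fun.comp) (use f'(1) c(1) in auto)
  moreover have "f (map (\<lambda>g. g xs) gs) = f' (map (\<lambda>g. g xs) (map c gs))" if "length xs = n" for xs
    using f'(2)[of "map (\<lambda>g. g xs) gs"] c(2) that by (simp add: o_def cong: map_cong)
  ultimately show ?thesis
    unfolding primrec_on_def by blast
qed

lemma primrec_on_comp1:
  assumes "primrec_on 1 (\<lambda>xs. f (xs ! 0))" and "primrec_on n a"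
  shows "primrec_on n (\<lambda>xs. f (a xs))"
  using primrec_on_compose[of "[a]" "\<lambda>xs. f (xs ! 0)" n] assms by simp

lemma primrec_on_comp2:
  assumes "primrec_on 2 (\<lambda>xs. f (xs ! 0) (xs ! 1))" and "primrec_on n a" and "primrec_on n b"
  shows "primrec_on n (\<lambda>xs. f (a xs) (b xs))"
  using primrec_on_compose[of "[a, b]" "\<lambda>xs. f (xs ! 0) (xs ! 1)" n] assms
  by (simp add: numeral_2_eq_2)

lemma primrec_on_Suc: "primrec_on n a \<Longrightarrow> primrec_on n (\<lambda>xs. Suc (a xs))"
  using primrec_on_comp1[of Suc n a] primrec_fun.succ unfolding primrec_on_def[of 1] by blast

lemma primrec_on_const: "primrec_on n (\<lambda>_. c)"
proof (induction c)
  case 0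
  show ?case unfolding primrec_on_def using primrec_fun.zero by blast
qed (rule primrec_on_Suc)

text \<open>The recursion scheme with the recursion bound given by an arbitrary primitive recursive
  function of the parameters.\<close>

lemma primrec_on_rec:
  assumes a: "primrec_on n a" and k: "primrec_on n k"
    and F: "primrec_on (n + 2) (\<lambda>ys. F (ys ! 0) (ys ! 1) (drop 2 ys))"
  shows "primrec_on n (\<lambda>xs. rec_nat (a xs) (\<lambda>y r. F y r xs) (k xs))"
proof -
  obtain a' where a': "primrec_fun n a'" "\<And>xs. length xs = n \<Longrightarrow> a xs = a' xs"
    using a unfolding primrec_on_def by blast
  obtain F' where F': "primrec_fun (n + 2) F'"
      "\<And>ys. length ys = n + 2 \<Longrightarrow> F (ys ! 0) (ys ! 1) (drop 2 ys) = F' ys"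
    using F unfolding primrec_on_def by blast
  have F'_eq: "F' (y # r # xs) = F y r xs" if "length xs = n" for y r xs
    using F'(2)[of "y # r # xs"] that by simp
  let ?h = "\<lambda>zs. rec_nat (a' (tl zs)) (\<lambda>y r. F' (y # r # tl zs)) (hd zs)"
  let ?gs = "k # map (\<lambda>i xs. xs ! i) [0..<n]"
  have "primrec_on (length ?gs) ?h"
    using primrec_fun.prec[OF a'(1) F'(1)] by (auto simp: primrec_on_def)
  moreover have "\<forall>g\<in>set ?gs. primrec_on n g"
    using k by (auto intro: primrec_on_proj)
  ultimately have "primrec_on n (\<lambda>xs. ?h (map (\<lambda>g. g xs) ?gs))"
    by (rule primrec_on_compose)
  moreover have "?h (map (\<lambda>g. g xs) ?gs) = rec_nat (a xs) (\<lambda>y r. F y r xs) (k xs)"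
    if "length xs = n" for xs
  proof -
    have "map (\<lambda>g. g xs) (map (\<lambda>i xs. xs ! i) [0..<n]) = xs"
      using that map_nth[of xs] by (simp add: o_def)
    then show ?thesis
      using a'(2) that by (simp add: F'_eq)
  qed
  ultimately show ?thesis
    by (subst primrec_on_cong) auto
qed

lemma primrec_on_if_zero:
  assumes "primrec_on n k" and "primrec_on n a" and "primrec_on n b"
  shows "primrec_on n (\<lambda>xs. if k xs = 0 then a xs else b xs)"
proof -
  have "primrec_on (n + 2) (\<lambda>ys. b (drop 2 ys))"
  proof -
    have "primrec_on (n + 2) (\<lambda>ys. b (map (\<lambda>g. g ys) (map (\<lambda>i ys. ys ! (i + 2)) [0..<n])))"
      by (rule primrec_on_compose) (use assms(3) in \<open>auto intro: primrec_on_proj\<close>)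
    moreover have "map (\<lambda>g. g ys) (map (\<lambda>i ys. ys ! (i + 2)) [0..<n]) = drop 2 ys"
      if "length ys = n + 2" for ys :: "nat list"
      using that by (intro nth_equalityI) auto
    ultimately show ?thesis
      by (subst primrec_on_cong) auto
  qed
  then have "primrec_on n (\<lambda>xs. rec_nat (a xs) (\<lambda>_ _. b xs) (k xs))"
    using assms by (intro primrec_on_rec) auto
  moreover have "rec_nat u (\<lambda>_ _. v) m = (if m = 0 then u else v)" for u v m :: nat
    by (cases m) auto
  ultimately show ?thesis
    by simp
qed

lemma primrec_on_if_rel:
  assumes "primrec_rel R" and "primrec_on n u" and "primrec_on n v"
    and "primrec_on n a" and "primrec_on n b"
  shows "primrec_on n (\<lambda>xs. if (u xs, v xs) \<in> R then a xs else b xs)"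
proof -
  have "primrec_on n (\<lambda>xs. if (u xs, v xs) \<in> R then 1 else 0)"
    using assms(1-3) unfolding primrec_rel_iff
    by (rule primrec_on_comp2[of "\<lambda>x y. if (x, y) \<in> R then 1 else 0"])
  from primrec_on_if_zero[OF this assms(5,4)] show ?thesis
    by (subst primrec_on_cong) auto
qed

lemma primrec_on_pred:
  assumes "primrec_on n a"
  shows "primrec_on n (\<lambda>xs. a xs - 1)"
proof (rule primrec_on_comp1[of "\<lambda>x. x - 1", OF _ assms])
  have "primrec_on 1 (\<lambda>xs. rec_nat 0 (\<lambda>y _. y) (xs ! 0))"
    by (intro primrec_on_rec primrec_on_const primrec_on_proj) auto
  moreover have "rec_nat 0 (\<lambda>y _. y) x = x - 1" for x :: nat
    by (cases x) auto
  ultimately show "primrec_on 1 (\<lambda>xs. xs ! 0 - 1)"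
    by simp
qed

lemma primrec_on_diff:
  assumes "primrec_on n a" and "primrec_on n b"
  shows "primrec_on n (\<lambda>xs. a xs - b xs)"
proof -
  have "primrec_on n (\<lambda>xs. rec_nat (a xs) (\<lambda>_ r. r - 1) (b xs))"
    by (intro primrec_on_rec primrec_on_pred primrec_on_proj assms) auto
  moreover have "rec_nat x (\<lambda>_ r. r - 1) y = x - y" for x y :: nat
    by (induction y) auto
  ultimately show ?thesis
    by simp
qed

lemmas primrec_on_intros =
  primrec_on_const primrec_on_Suc primrec_on_pred primrec_on_diff primrec_on_if_zero

section \<open>Punctual relations and reductions\<close>

lemma pr_leI:
  assumes "primrec_on 1 (\<lambda>xs. f (xs ! 0))" and "\<And>x y. (x, y) \<in> R \<longleftrightarrow> (f x, f y) \<in> S"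
  shows "R \<le>\<^sub>p S"
  using assms unfolding pr_le_def primrec1_iff by blast

lemma pr_leE:
  assumes "R \<le>\<^sub>p S"
  obtains f where "primrec_on 1 (\<lambda>xs. f (xs ! 0))" and "\<And>x y. (x, y) \<in> R \<longleftrightarrow> (f x, f y) \<in> S"
  using assms unfolding pr_le_def primrec1_iff by blast

lemma punctual_equivD:
  assumes "punctual R"
  shows "(x, x) \<in> R" and "(x, y) \<in> R \<Longrightarrow> (y, x) \<in> R"
    and "(x, y) \<in> R \<Longrightarrow> (y, z) \<in> R \<Longrightarrow> (x, z) \<in> R"
  using assms unfolding punctual_def equiv_def refl_on_def sym_def trans_def by blast+

text \<open>Infinitely many classes of \<open>R\<close> need infinitely many classes of \<open>S\<close>, since every class of
  \<open>R\<close> is the preimage of a class of \<open>S\<close>.\<close>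

lemma infinite_quotient_reduction:
  assumes "infinite (UNIV // R)" and "\<And>x y. (x, y) \<in> R \<longleftrightarrow> (f x, f y) \<in> S"
  shows "infinite (UNIV // S)"
proof
  have "UNIV // R \<subseteq> (\<lambda>C. f -` C) ` (UNIV // S)"
  proof
    fix C
    assume "C \<in> UNIV // R"
    then obtain x where "C = R `` {x}"
      by (auto simp: quotient_def)
    then have "C = f -` (S `` {f x})"
      using assms(2) by auto
    then show "C \<in> (\<lambda>C. f -` C) ` (UNIV // S)"
      by (simp add: quotientI)
  qed
  moreover assume "finite (UNIV // S)"
  ultimately show False
    using assms(1) finite_surj by blast
qed

lemma punctual_Id: "punctual Id"
proof -
  have "primrec_on 2 (\<lambda>xs. if xs ! 0 - xs ! 1 = 0 then if xs ! 1 - xs ! 0 = 0 then 1 else 0 else 0)"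
    by (intro primrec_on_intros primrec_on_proj) auto
  then have "primrec_rel Id"
    unfolding primrec_rel_iff by (rule primrec_on_cong[THEN iffD1, rotated]) auto
  moreover have "infinite (UNIV // (Id :: (nat \<times> nat) set))"
  proof
    assume "finite (UNIV // (Id :: (nat \<times> nat) set))"
    moreover have "UNIV // (Id :: (nat \<times> nat) set) = range (\<lambda>x. {x})"
      by (auto simp: quotient_def)
    ultimately show False
      using finite_imageD[of "\<lambda>x::nat. {x}" UNIV] by (simp add: inj_def)
  qed
  ultimately show ?thesis
    by (auto simp: punctual_def equiv_def refl_on_def sym_def trans_def)
qed

text \<open>The least element of its class is a primitive recursive invariant of an element: the
  candidate that is increased until it is equivalent to \<open>x\<close> stops at the least such number, and
  does so within \<open>x\<close> steps.\<close>

lemma pr_le_Id: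
  assumes "punctual R"
  shows "R \<le>\<^sub>p Id"
proof -
  define h where "h x n = rec_nat 0 (\<lambda>_ r. if (r, x) \<in> R then r else Suc r) n" for x n :: nat
  note R = punctual_equivD[OF assms]
  have h_eq: "h x n = min n (LEAST y. (y, x) \<in> R)" for x n
  proof (induction n)
    case (Suc n)
    show ?case
    proof (cases "n < (LEAST y. (y, x) \<in> R)")
      case True
      with not_less_Least[OF this] Suc show ?thesis by (auto simp: h_def)
    next
      case False
      with LeastI[of "\<lambda>y. (y, x) \<in> R", OF R(1)] Suc show ?thesis by (auto simp: h_def min_def)
    qed
  qed (simp add: h_def)
  have h_Least: "h x x = (LEAST y. (y, x) \<in> R)" for x
    using Least_le[of "\<lambda>y. (y, x) \<in> R", OF R(1)] by (simp add: h_eq)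
  show ?thesis
  proof (rule pr_leI[of "\<lambda>x. h x x"])
    have "primrec_rel R"
      using assms by (simp add: punctual_def)
    then have "primrec_on (1 + 2) (\<lambda>ys. if (ys ! 1, ys ! 2) \<in> R then ys ! 1 else Suc (ys ! 1))"
      by (intro primrec_on_if_rel primrec_on_Suc primrec_on_proj) auto
    then have "primrec_on (1 + 2)
        (\<lambda>ys. if (ys ! 1, drop 2 ys ! 0) \<in> R then ys ! 1 else Suc (ys ! 1))"
      by (rule primrec_on_cong[THEN iffD1, rotated]) auto
    then show "primrec_on 1 (\<lambda>xs. h (xs ! 0) (xs ! 0))"
      unfolding h_def by (intro primrec_on_rec primrec_on_const primrec_on_proj) auto
  next
    fix x y
    have "(LEAST z. (z, x) \<in> R) = (LEAST z. (z, y) \<in> R)" if xy: "(x, y) \<in> R"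
    proof -
      have "(z, x) \<in> R \<longleftrightarrow> (z, y) \<in> R" for z
        using xy R(2,3) by blast
      then show ?thesis by simp
    qed
    moreover have "(x, y) \<in> R" if eq: "(LEAST z. (z, x) \<in> R) = (LEAST z. (z, y) \<in> R)"
    proof -
      have Least: "((LEAST z. (z, w) \<in> R), w) \<in> R" for w
        using R(1) by (rule LeastI)
      show ?thesis
        using R(3)[OF R(2)[OF Least[of x]]] Least[of y] eq by simp
    qed
    ultimately show "(x, y) \<in> R \<longleftrightarrow> (h x x, h y y) \<in> Id"
      by (auto simp: h_Least)
  qed
qed

section \<open>Adding a class\<close>

definition add_class :: "(nat \<times> nat) set \<Rightarrow> (nat \<times> nat) set" where
  "add_class R = insert (0, 0) {(Suc x, Suc y) | x y. (x, y) \<in> R}"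

lemma add_class_simps [simp]:
  "(0, 0) \<in> add_class R" "(0, Suc y) \<notin> add_class R" "(Suc x, 0) \<notin> add_class R"
  "(Suc x, Suc y) \<in> add_class R \<longleftrightarrow> (x, y) \<in> R"
  by (auto simp: add_class_def)

lemma le_add_class: "R \<le>\<^sub>p add_class R"
  by (rule pr_leI[of Suc]) (auto intro: primrec_on_Suc primrec_on_proj)

lemma punctual_add_class:
  assumes "punctual R"
  shows "punctual (add_class R)"
  unfolding punctual_def
proof (intro conjI)
  note R = punctual_equivD[OF assms]
  have refl: "(x, x) \<in> add_class R" for x
    using R(1) by (cases x) auto
  have sym: "(y, x) \<in> add_class R" if "(x, y) \<in> add_class R" for x y
    using that by (cases x; cases y) (auto intro: R(2))
  have trans: "(x, z) \<in> add_class R" if "(x, y) \<in> add_class R" "(y, z) \<in> add_class R" for x y z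
    using that by (cases x; cases y; cases z; simp; blast intro: R(3))
  show "equiv UNIV (add_class R)"
  proof (rule equivI)
    show "refl (add_class R)"
      by (rule refl_onI) (rule refl)
    show "sym (add_class R)"
      by (rule symI) (rule sym)
    show "trans (add_class R)"
      by (rule transI) (rule trans)
  qed simp
  have "primrec_rel R"
    using assms by (simp add: punctual_def)
  then have "primrec_on 2 (\<lambda>xs. if xs ! 0 = 0 then if xs ! 1 = 0 then 1 else 0
      else if xs ! 1 = 0 then 0 else if (xs ! 0 - 1, xs ! 1 - 1) \<in> R then 1 else 0)"
    by (intro primrec_on_if_rel primrec_on_intros primrec_on_proj) auto
  then show "primrec_rel (add_class R)"
    unfolding primrec_rel_iff
    by (rule primrec_on_cong[THEN iffD1, rotated]) (auto simp: add_class_def gr0_conv_Suc)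
  show "infinite (UNIV // add_class R)"
    using assms infinite_quotient_reduction[of R Suc] by (simp add: punctual_def)
qed

lemma add_class_mono:
  assumes "R \<le>\<^sub>p S"
  shows "add_class R \<le>\<^sub>p add_class S"
proof -
  obtain f where f: "primrec_on 1 (\<lambda>xs. f (xs ! 0))" "\<And>x y. (x, y) \<in> R \<longleftrightarrow> (f x, f y) \<in> S"
    using assms by (rule pr_leE) blast
  show ?thesis
  proof (rule pr_leI[of "\<lambda>x. if x = 0 then 0 else Suc (f (x - 1))"])
    show "primrec_on 1 (\<lambda>xs. if xs ! 0 = 0 then 0 else Suc (f (xs ! 0 - 1)))"
      by (intro primrec_on_intros primrec_on_comp1[OF f(1)] primrec_on_proj) auto
    show "(x, y) \<in> add_class R \<longleftrightarrow>
        (if x = 0 then 0 else Suc (f (x - 1)), if y = 0 then 0 else Suc (f (y - 1)))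
          \<in> add_class S" for x y
      by (cases x; cases y) (auto simp: f(2))
  qed
qed

text \<open>A reduction \<open>f\<close> of the enlarged relations may send a class of \<open>R\<close> to the new class of \<open>S\<close>,
  but then it sends the new class of \<open>R\<close> to some class of \<open>S\<close>, which is otherwise not hit and can
  serve as the image instead.\<close>

lemma add_class_reflect:
  assumes "punctual S" and "add_class R \<le>\<^sub>p add_class S"
  shows "R \<le>\<^sub>p S"
proof -
  obtain f where f: "primrec_on 1 (\<lambda>xs. f (xs ! 0))"
      "\<And>x y. (x, y) \<in> add_class R \<longleftrightarrow> (f x, f y) \<in> add_class S"
    using assms(2) by (rule pr_leE) blast
  define g where "g x = (if f (Suc x) = 0 then f 0 - 1 else f (Suc x) - 1)" for x
  show ?thesis
  proof (rule pr_leI[of g])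
    show "primrec_on 1 (\<lambda>xs. g (xs ! 0))"
      unfolding g_def by (intro primrec_on_intros primrec_on_comp1[OF f(1)] primrec_on_proj) auto
    show "(x, y) \<in> R \<longleftrightarrow> (g x, g y) \<in> S" for x y
      using f(2)[of "Suc x" "Suc y"] f(2)[of 0 "Suc x"] f(2)[of 0 "Suc y"] f(2)[of "Suc x" 0]
        f(2)[of "Suc y" 0] punctual_equivD(1)[OF assms(1), of "f 0 - 1"]
      by (cases "f 0"; cases "f (Suc x)"; cases "f (Suc y)") (simp_all add: g_def)
  qed
qed

text \<open>The class of \<open>f 0\<close> is missed by the self-reduction \<open>\<lambda>x. f (Suc x)\<close> of \<open>R\<close>, so the iterates
  of \<open>f 0\<close> under it are pairwise inequivalent.\<close>

lemma Id_le_if_add_class_le: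
  assumes "punctual R" and "add_class R \<le>\<^sub>p R"
  shows "Id \<le>\<^sub>p R"
proof -
  obtain f where f: "primrec_on 1 (\<lambda>xs. f (xs ! 0))"
      "\<And>x y. (x, y) \<in> add_class R \<longleftrightarrow> (f x, f y) \<in> R"
    using assms(2) by (rule pr_leE) blast
  define g where "g n = rec_nat (f 0) (\<lambda>_ r. f (Suc r)) n" for n :: nat
  have "(g m, g n) \<in> R \<Longrightarrow> m = n" for m n
  proof (induction m arbitrary: n)
    case 0
    then show ?case
      using f(2)[of 0 "Suc _"] by (cases n) (auto simp: g_def)
  next
    case (Suc m)
    then show ?case
      using f(2)[of "Suc _" 0] f(2)[of "Suc (g m)" "Suc _"] by (cases n) (auto simp: g_def)
  qed
  then have "(m, n) \<in> Id \<longleftrightarrow> (g m, g n) \<in> R" for m n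
    using punctual_equivD(1)[OF assms(1)] by auto
  moreover have "primrec_on 1 (\<lambda>xs. g (xs ! 0))"
    unfolding g_def
    by (intro primrec_on_rec primrec_on_const primrec_on_comp1[OF f(1)] primrec_on_Suc primrec_on_proj)
      auto
  ultimately show ?thesis
    by (intro pr_leI)
qed

section \<open>Merging two classes\<close>

text \<open>Writing the merged relation as a preimage of \<open>R\<close> makes it an equivalence relation, and a
  primitive recursive one, for free. The class of \<open>m\<close> is absorbed by that of \<open>0\<close>.\<close>

definition merge_class :: "nat \<Rightarrow> (nat \<times> nat) set \<Rightarrow> (nat \<times> nat) set" where
  "merge_class m R = inv_image R (\<lambda>x. if (x, m) \<in> R then 0 else x)"

lemma punctual_merge_class:
  assumes "punctual R"
  shows "punctual (merge_class m R)"
  unfolding punctual_def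
proof (intro conjI)
  note R = punctual_equivD[OF assms]
  show "equiv UNIV (merge_class m R)"
    using assms
    unfolding punctual_def merge_class_def equiv_def refl_on_def sym_def trans_def inv_image_def
    by blast
  have "primrec_rel R"
    using assms by (simp add: punctual_def)
  then show "primrec_rel (merge_class m R)"
    unfolding primrec_rel_iff merge_class_def in_inv_image
    by (intro primrec_on_if_rel primrec_on_const primrec_on_proj) (auto simp: primrec_rel_iff)
  \<comment> \<open>Up to the removal of the class of \<open>m\<close>, the other classes of \<open>R\<close> are classes of the merged
    relation.\<close>
  have "UNIV // R \<subseteq> insert (R `` {m}) ((\<lambda>C. C - R `` {m}) ` (UNIV // merge_class m R))"
  proof
    fix C
    assume "C \<in> UNIV // R"
    then obtain x where C: "C = R `` {x}"
      by (auto simp: quotient_def)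
    show "C \<in> insert (R `` {m}) ((\<lambda>C. C - R `` {m}) ` (UNIV // merge_class m R))"
    proof (cases "(x, m) \<in> R")
      case True
      then have "C = R `` {m}"
        using C R by blast
      then show ?thesis by simp
    next
      case False
      then have "(y, m) \<notin> R" if "(x, y) \<in> R" for y
        using that R(3) by blast
      moreover have "(m, y) \<in> R \<longleftrightarrow> (y, m) \<in> R" for y
        using R(2) by blast
      ultimately have "C = merge_class m R `` {x} - R `` {m}"
        using C False by (auto simp: merge_class_def)
      moreover have "merge_class m R `` {x} \<in> UNIV // merge_class m R"
        by (simp add: quotientI)
      ultimately show ?thesis by blast
    qed
  qed
  then show "infinite (UNIV // merge_class m R)"
    using assms unfolding punctual_def by (meson finite_imageI finite_insert finite_subset)
qed

text \<open>Merging is inverse to adding a class up to equivalence: the new class stands for the absorbed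
  class of \<open>m\<close>.\<close>

lemma add_class_merge_class:
  assumes "punctual R" and "(0, m) \<notin> R"
  shows "add_class (merge_class m R) \<le>\<^sub>p R" and "R \<le>\<^sub>p add_class (merge_class m R)"
proof -
  note R = punctual_equivD[OF assms(1)]
  have rel: "primrec_rel R"
    using assms(1) by (simp add: punctual_def)
  define r where "r x = (if (x, m) \<in> R then 0 else x)" for x
  have merge_iff: "(x, y) \<in> merge_class m R \<longleftrightarrow> (r x, r y) \<in> R" for x y
    by (simp add: merge_class_def r_def)
  have r: "(r x, m) \<notin> R" "(m, r x) \<notin> R" for x
    using assms(2) R(2) unfolding r_def by (cases "(x, m) \<in> R"; auto)+
  define f where "f x = (if x = 0 then m else r (x - 1))" for x
  show "add_class (merge_class m R) \<le>\<^sub>p R"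
  proof (rule pr_leI[of f])
    show "primrec_on 1 (\<lambda>xs. f (xs ! 0))"
      unfolding f_def r_def
      by (intro primrec_on_intros primrec_on_if_rel[OF rel] primrec_on_proj) auto
    show "(x, y) \<in> add_class (merge_class m R) \<longleftrightarrow> (f x, f y) \<in> R" for x y
      using r R(1) by (cases x; cases y) (simp_all add: f_def merge_iff)
  qed
  define g where "g x = (if (x, m) \<in> R then 0 else Suc x)" for x
  show "R \<le>\<^sub>p add_class (merge_class m R)"
  proof (rule pr_leI[of g])
    show "primrec_on 1 (\<lambda>xs. g (xs ! 0))"
      unfolding g_def by (intro primrec_on_intros primrec_on_if_rel[OF rel] primrec_on_proj) auto
    show "(x, y) \<in> R \<longleftrightarrow> (g x, g y) \<in> add_class (merge_class m R)" for x y
    proof (cases "(x, m) \<in> R"; cases "(y, m) \<in> R")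
      assume "(x, m) \<in> R" "(y, m) \<in> R"
      then have "(x, y) \<in> R" using R by blast
      then show ?thesis by (simp add: g_def \<open>(x, m) \<in> R\<close> \<open>(y, m) \<in> R\<close>)
    next
      assume "(x, m) \<in> R" "(y, m) \<notin> R"
      then have "(x, y) \<notin> R" using R by blast
      then show ?thesis by (simp add: g_def \<open>(x, m) \<in> R\<close> \<open>(y, m) \<notin> R\<close>)
    next
      assume "(x, m) \<notin> R" "(y, m) \<in> R"
      then have "(x, y) \<notin> R" using R by blast
      then show ?thesis by (simp add: g_def \<open>(x, m) \<notin> R\<close> \<open>(y, m) \<in> R\<close>)
    next
      assume "(x, m) \<notin> R" "(y, m) \<notin> R"
      then show ?thesis by (simp add: g_def merge_class_def)
    qed
  qed
qed

lemma add_class_surj: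
  assumes "punctual R"
  obtains S where "punctual S" and "add_class S \<le>\<^sub>p R" and "R \<le>\<^sub>p add_class S"
proof -
  obtain m where "(0, m) \<notin> R"
  proof (rule ccontr)
    assume "\<not> thesis"
    with that have "(0, m) \<in> R" for m
      by blast
    then have "(x, y) \<in> R" for x y
      using punctual_equivD[OF assms] by blast
    then have "UNIV // R \<subseteq> {UNIV}"
      by (auto simp: quotient_def)
    then show False
      using assms finite_subset[of _ "{UNIV}"] by (auto simp: punctual_def)
  qed
  with that punctual_merge_class add_class_merge_class assms show thesis
    by blast
qed

section \<open>The automorphism of the degrees\<close>

lemma PeqE:
  assumes "d \<in> Peq"
  obtains R where "punctual R" and "d = deg R"
  using assms unfolding Peq_def deg_def by (auto elim: quotientE)

lemma deg_in_Peq: "punctual R \<Longrightarrow> deg R \<in> Peq"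
  unfolding Peq_def deg_def by (simp add: quotientI)

lemma deg_eq_iff:
  assumes "punctual R" and "punctual S"
  shows "deg R = deg S \<longleftrightarrow> R \<le>\<^sub>p S \<and> S \<le>\<^sub>p R"
  using eq_equiv_class_iff[OF equiv_pr_equiv, of R S] assms
  unfolding deg_def pr_equiv_def by simp

definition add_class_deg :: "(nat \<times> nat) set set \<Rightarrow> (nat \<times> nat) set set" where
  "add_class_deg d = (\<Union>R\<in>d. deg (add_class R))"

lemma add_class_deg_deg:
  assumes "punctual R"
  shows "add_class_deg (deg R) = deg (add_class R)"
proof -
  have "(\<lambda>R. deg (add_class R)) respects pr_equiv"
    by (auto simp: congruent_def pr_equiv_def deg_eq_iff punctual_add_class add_class_mono)
  then show ?thesis
    using assms unfolding add_class_deg_def deg_def[of R]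
    by (simp add: UN_equiv_class[OF equiv_pr_equiv])
qed

lemma add_class_deg_le_iff:
  assumes "a \<in> Peq" and "b \<in> Peq"
  shows "Peq_le (add_class_deg a) (add_class_deg b) \<longleftrightarrow> Peq_le a b"
  using assms
  by (elim PeqE) (simp add: add_class_deg_deg Peq_le_deg punctual_add_class,
      blast intro: add_class_mono add_class_reflect)

lemma bij_betw_add_class_deg: "bij_betw add_class_deg Peq Peq"
proof (rule bij_betwI')
  fix a b
  assume "a \<in> Peq" "b \<in> Peq"
  then show "add_class_deg a = add_class_deg b \<longleftrightarrow> a = b"
    by (elim PeqE) (simp add: add_class_deg_deg deg_eq_iff punctual_add_class,
        blast intro: add_class_mono add_class_reflect)
next
  fix a
  assume "a \<in> Peq"
  then show "add_class_deg a \<in> Peq"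
    by (elim PeqE) (simp add: add_class_deg_deg deg_in_Peq punctual_add_class)
next
  fix b
  assume "b \<in> Peq"
  then obtain R where R: "punctual R" "b = deg R"
    by (rule PeqE)
  then obtain S where S: "punctual S" "add_class S \<le>\<^sub>p R" "R \<le>\<^sub>p add_class S"
    using add_class_surj by blast
  then have "b = add_class_deg (deg S)"
    using R by (simp add: add_class_deg_deg deg_eq_iff punctual_add_class)
  with S show "\<exists>a\<in>Peq. b = add_class_deg a"
    using deg_in_Peq by blast
qed

text \<open>The orbit of a degree is an ascending chain. It is strict at every step, because a collapse at
  some step would be reflected down to the first one.\<close>

lemma infinite_orbit:
  assumes "punctual R" and "\<not> Id \<le>\<^sub>p R"
  shows "infinite (range (\<lambda>n. (add_class_deg ^^ n) (deg R)))"
proof -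
  have punctual: "punctual ((add_class ^^ n) R)" for n
    by (induction n) (auto simp: assms(1) punctual_add_class)
  have orbit: "(add_class_deg ^^ n) (deg R) = deg ((add_class ^^ n) R)" for n
    by (induction n) (auto simp: add_class_deg_deg punctual)
  have ascending: "(add_class ^^ m) R \<le>\<^sub>p (add_class ^^ n) R" if "m \<le> n" for m n
    using that by (induction rule: dec_induct) (auto intro: pr_le_refl pr_le_trans le_add_class)
  have strict: "\<not> (add_class ^^ Suc n) R \<le>\<^sub>p (add_class ^^ n) R" for n
  proof (induction n)
    case 0
    show ?case using Id_le_if_add_class_le assms by auto
  next
    case (Suc n)
    then show ?case using add_class_reflect punctual by (metis comp_apply funpow.simps(2))
  qed
  have "\<not> (add_class ^^ n) R \<le>\<^sub>p (add_class ^^ m) R" if "m < n" for m n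
    using that strict[of m] ascending[of "Suc m" n] pr_le_trans by (meson Suc_leI)
  then have "inj (\<lambda>n. (add_class_deg ^^ n) (deg R))"
    by (intro linorder_injI) (auto simp: orbit deg_eq_iff punctual)
  then show ?thesis
    using finite_imageD infinite_UNIV_nat by blast
qed

section \<open>Definability\<close>

lemma sat_automorphism:
  assumes \<sigma>: "bij_betw \<sigma> M M" and le: "\<And>a b. a \<in> M \<Longrightarrow> b \<in> M \<Longrightarrow> le (\<sigma> a) (\<sigma> b) \<longleftrightarrow> le a b"
    and "\<And>x. e x \<in> M"
  shows "sat M le (\<lambda>x. \<sigma> (e x)) p \<longleftrightarrow> sat M le e p"
  using assms(3)
proof (induction p arbitrary: e)
  case (Eq x y)
  then show ?case
    using \<sigma> inj_on_eq_iff[of \<sigma> M "e x" "e y"] by (simp add: bij_betw_def)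
next
  case (Leq x y)
  then show ?case
    by (simp add: le)
next
  case (Exi x p)
  have "sat M le ((\<lambda>y. \<sigma> (e y))(x := \<sigma> a)) p \<longleftrightarrow> sat M le (e(x := a)) p" if "a \<in> M" for a
  proof -
    have upd: "(\<lambda>y. \<sigma> (e y))(x := \<sigma> a) = (\<lambda>y. \<sigma> ((e(x := a)) y))"
      by auto
    show ?thesis
      unfolding upd by (rule Exi.IH) (simp add: Exi.prems that)
  qed
  moreover have "sat M le (\<lambda>x. \<sigma> (e x)) (Exi x p) \<longleftrightarrow>
      (\<exists>b\<in>\<sigma> ` M. sat M le ((\<lambda>y. \<sigma> (e y))(x := b)) p)"
    using \<sigma> by (simp add: bij_betw_def)
  ultimately show ?case
    by (simp del: fun_upd_apply)
qed simp_all

lemma definable_set_closed: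
  assumes "definable_set M le A" and \<sigma>: "bij_betw \<sigma> M M"
    and "\<And>a b. a \<in> M \<Longrightarrow> b \<in> M \<Longrightarrow> le (\<sigma> a) (\<sigma> b) \<longleftrightarrow> le a b" and "a \<in> A"
  shows "(\<sigma> ^^ n) a \<in> A"
proof (induction n)
  case (Suc n)
  obtain p where A: "A = {a \<in> M. sat M le (\<lambda>_. a) p}"
    using assms(1) unfolding definable_set_def by blast
  then show ?case
    using Suc sat_automorphism[of \<sigma> M le "\<lambda>_. (\<sigma> ^^ n) a" p] assms(3) \<sigma>
    by (auto simp: bij_betw_def)
qed (simp add: assms(4))

text \<open>The formula says that no element fails to lie below the free variable.\<close>

lemma definable_set_greatest:
  assumes "t \<in> M" and "\<And>a. a \<in> M \<Longrightarrow> le a t"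
    and "\<And>a. a \<in> M \<Longrightarrow> le t a \<Longrightarrow> a = t"
  shows "definable_set M le {t}"
  unfolding definable_set_def
proof (intro exI conjI)
  let ?p = "Neg (Exi 1 (Neg (Leq 1 0)))"
  show "free_vars ?p \<subseteq> {0}"
    by auto
  have "sat M le (\<lambda>_. a) ?p \<longleftrightarrow> (\<forall>b\<in>M. le b a)" for a
    by simp
  then show "{t} = {a \<in> M. sat M le (\<lambda>_. a) ?p}"
    using assms by blast
qed

theorem corollary9p11:
  shows "(deg Id \<in> Peq \<and> (\<forall>d\<in>Peq. Peq_le d (deg Id))) \<and>
    (\<forall>d\<in>Peq. definable_elem Peq Peq_le d \<longleftrightarrow> d = deg Id) \<and>
    (\<forall>A. A \<subseteq> Peq \<and> finite A \<and> A \<noteq> {} \<longrightarrow>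
       (definable_set Peq Peq_le A \<longleftrightarrow> A = {deg Id}))"
proof -
  have top: "Peq_le d (deg Id)" if "d \<in> Peq" for d
    using that punctual_Id by (auto elim!: PeqE simp: Peq_le_deg pr_le_Id)
  have in_Peq: "deg Id \<in> Peq"
    by (simp add: deg_in_Peq punctual_Id)
  have eq_top: "d = deg Id" if "d \<in> Peq" "Peq_le (deg Id) d" for d
    using that punctual_Id by (elim PeqE) (simp add: Peq_le_deg deg_eq_iff pr_le_Id)
  have Id_definable: "definable_set Peq Peq_le {deg Id}"
    using top eq_top in_Peq by (intro definable_set_greatest)
  have finite_definable: "A = {deg Id}"
    if A: "A \<subseteq> Peq" "finite A" "A \<noteq> {}" "definable_set Peq Peq_le A" for A
  proof -
    have "d = deg Id" if d: "d \<in> A" for d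
    proof -
      obtain R where R: "punctual R" "d = deg R"
        using d A(1) by (blast elim: PeqE)
      have "range (\<lambda>n. (add_class_deg ^^ n) d) \<subseteq> A"
        using definable_set_closed[OF A(4) bij_betw_add_class_deg add_class_deg_le_iff d] by blast
      then have "Id \<le>\<^sub>p R"
        using infinite_orbit[OF R(1)] R(2) A(2) finite_subset by blast
      with R show ?thesis
        by (simp add: deg_eq_iff punctual_Id pr_le_Id)
    qed
    with A(3) show ?thesis
      by blast
  qed
  have "definable_elem Peq Peq_le d \<longleftrightarrow> d = deg Id" if "d \<in> Peq" for d
    using finite_definable[of "{d}"] Id_definable that by (auto simp: definable_elem_def)
  with top in_Peq Id_definable finite_definable show ?thesis
    by blast
qed

end
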